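(* Let $\tau$ be a finite relational vocabulary, $\mathcal{M}$ a finite collection of minor quantifiers, $s:\{=\}\cup\tau\cup\mathcal{M}\to\mathbb{Z}_+$ a cost function, $\mathcal{A}$ and $\mathcal{B}$ classes of $\tau$-pairs, and $b\in\mathbb{Z}_+$ a budget. Then Player $\mathbb{I}$ has a winning strategy in the $\mathrm{FC}_b\{\mathcal{M}\}(\mathcal{A},\mathcal{B})$-game if and only if $\mathcal{A}$ and $\mathcal{B}$ are separable by an $\mathrm{FO}(\mathcal{M})$-formula of cost $\leq b$.
   Context: **Models and assignments.** $\tau$ is a finite set of relation symbols with arities in $\mathbb{N}$. A $\tau$-model $\mathfrak{A}$ has a non-empty, possibly infinite domain $A$ and a relation $R^{\mathfrak{A}}\subseteq A^k$ for each $k$-ary $R\in\tau$. $\mathrm{VAR}$ is a countably infinite set of variables. An assignment over $\mathfrak{A}$ is a (possibly empty) function $f:X\to A$ with $X\subseteq\mathrm{VAR}$ finite. For $\mathbf{x}\in\mathrm{VAR}^n$, a tuple $\mathbf{a}\in A^n$ *respects $\mathbf{x}$-repetitions* if $\mathbf{x}(i)=\mathbf{x}(j)$ implies $\mathbf{a}(i)=\mathbf{a}(j)$; a set of tuples does so if all its members do. For such $\mathbf{a}$, $f\frac{\mathbf{a}}{\mathbf{x}}$ is the assignment with domain $\mathrm{dom}(f)\cup\{\mathbf{x}(1),\dots,\mathbf{x}(n)\}$ mapping $\mathbf{x}(i)$ to $\mathbf{a}(i)$ and agreeing with $f$ elsewhere (for $n=0$ it is $f$). A $\tau$-pair is a pair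 $(\mathfrak{A},f)$ with $f$ an assignment over the $\tau$-model $\mathfrak{A}$. **Generalized and minor quantifiers.** A generalized quantifier of width $k\in\mathbb{N}$ and type $\mathbf{n}\in\mathbb{N}^k$ is an isomorphism-closed class $Q$ of structures $(D,P_1,\dots,P_k)$ with $D\ne\emptyset$, $P_j\subseteq D^{\mathbf{n}(j)}$ (here $D^0=\{\emptyset\}$); $\overline{Q}$ is the class of structures of the same form not in $Q$. An isomorphism-closed class $\mathcal{C}$ of structures $(D,P_+^1,\dots,P_+^k,P_-^1,\dots,P_-^k)$ *witnesses* $Q$ if: (1) for each member, $D\neq\emptyset$ and, for each $j$, $P_+^j\cup P_-^j\subseteq D^{\mathbf{n}(j)}$ and $P_+^j\cap P_-^j=\emptyset$; (2) for each $(D,P_1,\dots,P_k)\in Q$ there is $(D,P_+^1,\dots,P_+^k,P_-^1,\dots,P_-^k)\in\mathcal{C}$ with $P_+^j\subseteq P_j$ and $P_-^j\subseteq D^{\mathbf{n}(j)}\setminus P_j$ for all $j$; (3) for each $(D,P_+^1,\dots,P_+^k,P_-^1,\dots,P_-^k)\in\mathcal{C}$ there is no $(D,P_1,\dots,P_k)\in\overline{Q}$ with $P_+^j\subseteq P_j$ and $P_-^j\subseteq D^{\mathbf{n}(j)}\setminus P_j$ for all $j$. A *minor* of $Q$ is a pair $M=(\mathcal{C},\mathcal{D})$ where $\mathcal{C}$ witnesses $Q$ and $\mathcal{D}$ witnesses $\overline{Q}$; it has the width and type of $Q$. A minor quantifier is a minor of some generalized quantifier. **Logic.** $\mathrm{FO}(\mathcal{M})$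 is generated from the atomic formulas $x=y$ and $R(x_1,\dots,x_k)$ by forming $M\mathbf{x}_1,\dots,\mathbf{x}_k(\varphi_1,\dots,\varphi_k)$ with $M\in\mathcal{M}$ of width $k$ and type $\mathbf{n}$, $\mathbf{x}_j\in\mathrm{VAR}^{\mathbf{n}(j)}$ (width $0$ gives the formula $M$; connectives occur only as quantifiers in $\mathcal{M}$ all of whose type entries are $0$, if at all). Let $\|\varphi\|^{\mathfrak{A},f}_{\mathbf{x}}=\{\mathbf{a}\mid \mathbf{a}\text{ respects }\mathbf{x}\text{-repetitions and }\mathfrak{A},f\frac{\mathbf{a}}{\mathbf{x}}\models\varphi\}$. Atoms are interpreted as usual, and $\mathfrak{A},f\models M\mathbf{x}_1,\dots,\mathbf{x}_k(\varphi_1,\dots,\varphi_k)$, with $M=(\mathcal{C},\mathcal{D})$, iff there is $(A,P_{1,+},\dots,P_{k,+},P_{1,-},\dots,P_{k,-})\in\mathcal{C}$ with $P_{j,+}\subseteq\|\varphi_j\|^{\mathfrak{A},f}_{\mathbf{x}_j}$ and $P_{j,-}\subseteq A^{\mathbf{n}(j)}\setminus\|\varphi_j\|^{\mathfrak{A},f}_{\mathbf{x}_j}$ for each $j$. Here $\mathrm{dom}(f)$ contains the free variables of the formula being evaluated (variables in $\mathbf{x}_j$ are bound in $\varphi_j$). A formula $\varphi$ separates $\mathcal{A}$ and $\mathcal{B}$ if $\mathfrak{A},f\models\varphi$ for all $(\mathfrak{A},f)\in\mathcal{A}$ and $\mathfrak{B},g\not\models\varphi$ for all $(\mathfrak{B},g)\in\mathcal{B}$.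 **Cost.** The cost $s(\varphi)$ of a formula is the sum of the costs of the symbols ($=$, relation symbols, minor quantifiers) present in it, counted with multiplicity. $s_{\min}$ is the smallest cost of an atomic formula or a width-$0$ minor quantifier in $\mathcal{M}$. **The game.** $\mathrm{FC}_b\{\mathcal{M}\}(\mathcal{A},\mathcal{B})$ is a two-player game starting in position $(b,\mathcal{A},\mathcal{B})$. A round from position $(s_i,\mathcal{A}_i,\mathcal{B}_i)$ goes as follows. 1. If $s_i<s_{\min}$, Player $\mathbb{II}$ wins. Otherwise Player $\mathbb{I}$ chooses $\varphi$: an atomic formula of cost $\le s_i$ or a width-$0$ minor quantifier in $\mathcal{M}$ of cost $\le s_i$. If $\varphi$ separates $\mathcal{A}_i$ and $\mathcal{B}_i$, Player $\mathbb{I}$ wins; otherwise the round continues. 2. Player $\mathbb{I}$ chooses $M=(\mathcal{C},\mathcal{D})\in\mathcal{M}$ of width $k\in\mathbb{Z}_+$ and type $\mathbf{n}\in\mathbb{N}^k$, tuples $\mathbf{x}_j\in\mathrm{VAR}^{\mathbf{n}(j)}$ ($1\le j\le k$), and $u_1,\dots,u_k\in\mathbb{Z}_+$ with $u_1+\dots+u_k=s_i-s(M)$. For each $j$ and each $(\mathfrak{A},f)\in\mathcal{A}_i$ he chooses a witness set $P_{j,+}^{\mathfrak{A},f}\subseteq A^{\mathbf{n}(j)}$ and a falsifier set $P_{j,-}^{\mathfrak{A},f}\subseteq A^{\mathbf{n}(j)}$, both of which respect $\mathbf{x}_j$-repetitions, such that $(A,P_{1,+}^{\mathfrak{A},f},\dots,P_{k,+}^{\mathfrak{A},f},P_{1,-}^{\mathfrak{A},f},\dots,P_{k,-}^{\mathfrak{A},f})\in\mathcal{C}$.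 For each $j$ and each $(\mathfrak{B},g)\in\mathcal{B}_i$ he also chooses a witness set $P_{j,+}^{\mathfrak{B},g}\subseteq B^{\mathbf{n}(j)}$ and a falsifier set $P_{j,-}^{\mathfrak{B},g}\subseteq B^{\mathbf{n}(j)}$, both of which respect $\mathbf{x}_j$-repetitions, such that $(B,P_{1,+}^{\mathfrak{B},g},\dots,P_{k,+}^{\mathfrak{B},g},P_{1,-}^{\mathfrak{B},g},\dots,P_{k,-}^{\mathfrak{B},g})\in\mathcal{D}$. If such choices do not exist, Player $\mathbb{II}$ wins immediately. 3. Player $\mathbb{II}$ chooses $j\in\{1,\dots,k\}$. The next position is $(u_j,\mathcal{A}'_j,\mathcal{B}'_j)$, where $\mathcal{A}'_j=\{(\mathfrak{C},h\frac{\mathbf{c}}{\mathbf{x}_j})\mid(\mathfrak{C},h)\in\mathcal{A}_i\cup\mathcal{B}_i,\ \mathbf{c}\in P_{j,+}^{\mathfrak{C},h}\}$ and $\mathcal{B}'_j=\{(\mathfrak{C},h\frac{\mathbf{c}}{\mathbf{x}_j})\mid(\mathfrak{C},h)\in\mathcal{A}_i\cup\mathcal{B}_i,\ \mathbf{c}\in P_{j,-}^{\mathfrak{C},h}\}$.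
   Formalization: Falsifier sets need not respect repetitions (tuples violating them are dropped from the next position), since otherwise the claim fails; and an atom with a variable outside dom(f) counts as not satisfied, in formulas and in the game alike. *)

theory Defs
  imports Main
begin

text \<open>
  Everything is relative to a type \<open>'a\<close> of potential domain elements: domains are non-empty
  subsets of \<open>'a\<close>, and classes of structures are sets.  Tuples are lists; the only
  tuple of length \<open>0\<close> is the empty list.
\<close>

definition tuples :: "'a set \<Rightarrow> nat \<Rightarrow> 'a list set" where
  "tuples D n = {cs. length cs = n \<and> set cs \<subseteq> D}"


section \<open>Models and assignments\<close>

text \<open>A relational vocabulary is a set \<open>\<tau> :: 'r set\<close> with an arity function \<open>ar\<close>.\<close>

record ('r, 'a) model =
  univ :: "'a set"
  interp :: "'r \<Rightarrow> 'a list set"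

definition is_model :: "'r set \<Rightarrow> ('r \<Rightarrow> nat) \<Rightarrow> ('r, 'a) model \<Rightarrow> bool" where
  "is_model \<tau> ar \<AA> \<longleftrightarrow> univ \<AA> \<noteq> {} \<and>
     (\<forall>R\<in>\<tau>. interp \<AA> R \<subseteq> tuples (univ \<AA>) (ar R)) \<and>
     (\<forall>R. R \<notin> \<tau> \<longrightarrow> interp \<AA> R = {})"

type_synonym var = nat
type_synonym 'a assignment = "var \<rightharpoonup> 'a"
type_synonym ('r, 'a) pair = "('r, 'a) model \<times> 'a assignment"

definition is_assignment :: "'a set \<Rightarrow> 'a assignment \<Rightarrow> bool" where
  "is_assignment D f \<longleftrightarrow> finite (dom f) \<and> ran f \<subseteq> D"

definition is_pair :: "'r set \<Rightarrow> ('r \<Rightarrow> nat) \<Rightarrow> ('r, 'a) pair \<Rightarrow> bool" where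
  "is_pair \<tau> ar p \<longleftrightarrow> is_model \<tau> ar (fst p) \<and> is_assignment (univ (fst p)) (snd p)"

definition respects_reps :: "var list \<Rightarrow> 'a list \<Rightarrow> bool" where
  "respects_reps xs cs \<longleftrightarrow> length cs = length xs \<and>
     (\<forall>i<length xs. \<forall>j<length xs. xs ! i = xs ! j \<longrightarrow> cs ! i = cs ! j)"

text \<open>For \<open>respects_reps xs cs\<close>, the updated assignment is the library's \<open>f(xs [\<mapsto>] cs)\<close>.\<close>


section \<open>Generalized quantifiers and minor quantifiers\<close>

type_synonym 'a qstruct = "'a set \<times> 'a list set list"
type_synonym 'a wstruct = "'a set \<times> 'a list set list \<times> 'a list set list"

definition iso_closed :: "'a qstruct set \<Rightarrow> bool" where
  "iso_closed Q \<longleftrightarrow> (\<forall>D Ps E h. (D, Ps) \<in> Q \<longrightarrow> bij_betw h D E \<longrightarrow>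
     (E, map ((`) (map h)) Ps) \<in> Q)"

definition iso_closed_w :: "'a wstruct set \<Rightarrow> bool" where
  "iso_closed_w C \<longleftrightarrow> (\<forall>D Ps Ns E h. (D, Ps, Ns) \<in> C \<longrightarrow> bij_betw h D E \<longrightarrow>
     (E, map ((`) (map h)) Ps, map ((`) (map h)) Ns) \<in> C)"

definition qstructs :: "nat list \<Rightarrow> 'a qstruct set" where
  "qstructs n = {(D, Ps). D \<noteq> {} \<and> length Ps = length n \<and>
     (\<forall>j<length n. Ps ! j \<subseteq> tuples D (n ! j))}"

definition gen_quantifier :: "nat list \<Rightarrow> 'a qstruct set \<Rightarrow> bool" where
  "gen_quantifier n Q \<longleftrightarrow> Q \<subseteq> qstructs n \<and> iso_closed Q"

definition wstructs :: "nat list \<Rightarrow> 'a wstruct set" where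
  "wstructs n = {(D, Ps, Ns). D \<noteq> {} \<and> length Ps = length n \<and> length Ns = length n \<and>
     (\<forall>j<length n. Ps ! j \<union> Ns ! j \<subseteq> tuples D (n ! j) \<and> Ps ! j \<inter> Ns ! j = {})}"

definition fits :: "nat list \<Rightarrow> 'a wstruct \<Rightarrow> 'a qstruct \<Rightarrow> bool" where
  "fits n W S \<longleftrightarrow> (case (W, S) of ((D, Ps, Ns), (E, Qs)) \<Rightarrow> D = E \<and>
     (\<forall>j<length n. Ps ! j \<subseteq> Qs ! j \<and> Ns ! j \<subseteq> tuples D (n ! j) - Qs ! j))"

definition witnesses :: "nat list \<Rightarrow> 'a wstruct set \<Rightarrow> 'a qstruct set \<Rightarrow> bool" where
  "witnesses n C Q \<longleftrightarrow> iso_closed_w C \<and> C \<subseteq> wstructs n \<and>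
     (\<forall>S\<in>Q. \<exists>W\<in>C. fits n W S) \<and>
     (\<forall>W\<in>C. \<not> (\<exists>S\<in>qstructs n - Q. fits n W S))"

text \<open>The type is part of the data, since \<open>(\<C>, \<D>)\<close> need not determine it: all
  relations in \<open>\<C>\<close> and \<open>\<D>\<close> may be empty.\<close>

datatype 'a minor = Minor (mtype: "nat list") (pos: "'a wstruct set") (neg: "'a wstruct set")

definition width :: "'a minor \<Rightarrow> nat" where
  "width M = length (mtype M)"

definition is_minor_of :: "'a minor \<Rightarrow> 'a qstruct set \<Rightarrow> bool" where
  "is_minor_of M Q \<longleftrightarrow> gen_quantifier (mtype M) Q \<and>
     witnesses (mtype M) (pos M) Q \<and> witnesses (mtype M) (neg M) (qstructs (mtype M) - Q)"

definition minor_quantifier :: "'a minor \<Rightarrow> bool" where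
  "minor_quantifier M \<longleftrightarrow> (\<exists>Q. is_minor_of M Q)"


section \<open>The logic\<close>

datatype ('r, 'a) fm =
    Eq var var
  | Rel 'r "var list"
  | Quant "'a minor" "var list list" "('r, 'a) fm list"

inductive FO :: "'r set \<Rightarrow> ('r \<Rightarrow> nat) \<Rightarrow> 'a minor set \<Rightarrow> ('r, 'a) fm \<Rightarrow> bool"
  for \<tau> ar \<M> where
    "FO \<tau> ar \<M> (Eq x y)"
  | "R \<in> \<tau> \<Longrightarrow> length xs = ar R \<Longrightarrow> FO \<tau> ar \<M> (Rel R xs)"
  | "M \<in> \<M> \<Longrightarrow> map length xss = mtype M \<Longrightarrow> length \<phi>s = width M \<Longrightarrow>
       (\<forall>\<phi>\<in>set \<phi>s. FO \<tau> ar \<M> \<phi>) \<Longrightarrow> FO \<tau> ar \<M> (Quant M xss \<phi>s)"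

lemma size_nth_list [termination_simp]: "j < length xs \<Longrightarrow> size (xs ! j) < Suc (k + size_list size xs)"
  using size_list_estimation'[of "xs ! j" xs "size (xs ! j)" size] by simp

text \<open>
  Satisfaction is total: an atom mentioning a variable outside \<open>dom f\<close> is not
  satisfied by \<open>f\<close>.  When \<open>dom f\<close> contains the free variables of the formula this is the
  usual semantics.  The convention is needed because a class of assignments reached in the game
  may be empty, or come from only some of the assignments in the preceding classes, so that
  Player I may win there with an atom whose variables are not in the domain of all the
  assignments he started from.
\<close>

fun sat :: "('r, 'a) model \<Rightarrow> 'a assignment \<Rightarrow> ('r, 'a) fm \<Rightarrow> bool" where
  "sat \<AA> f (Eq x y) \<longleftrightarrow> x \<in> dom f \<and> y \<in> dom f \<and> f x = f y"
| "sat \<AA> f (Rel R xs) \<longleftrightarrow> set xs \<subseteq> dom f \<and> map (the \<circ> f) xs \<in> interp \<AA> R"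
| "sat \<AA> f (Quant M xss \<phi>s) \<longleftrightarrow> (\<exists>Ps Ns. (univ \<AA>, Ps, Ns) \<in> pos M \<and>
     (\<forall>j<length \<phi>s.
        let ext = {cs \<in> tuples (univ \<AA>) (mtype M ! j).
                     respects_reps (xss ! j) cs \<and> sat \<AA> (f(xss ! j [\<mapsto>] cs)) (\<phi>s ! j)}
        in Ps ! j \<subseteq> ext \<and> Ns ! j \<subseteq> tuples (univ \<AA>) (mtype M ! j) - ext))"

definition separates :: "('r, 'a) fm \<Rightarrow> ('r, 'a) pair set \<Rightarrow> ('r, 'a) pair set \<Rightarrow> bool" where
  "separates \<phi> \<A> \<B> \<longleftrightarrow> (\<forall>(\<AA>, f)\<in>\<A>. sat \<AA> f \<phi>) \<and> (\<forall>(\<BB>, g)\<in>\<B>. \<not> sat \<BB> g \<phi>)"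


section \<open>Costs\<close>

datatype ('r, 'a) symbol = EqSym | RelSym 'r | QuantSym "'a minor"

definition symbols :: "'r set \<Rightarrow> 'a minor set \<Rightarrow> ('r, 'a) symbol set" where
  "symbols \<tau> \<M> = {EqSym} \<union> RelSym ` \<tau> \<union> QuantSym ` \<M>"

primrec cost :: "(('r, 'a) symbol \<Rightarrow> nat) \<Rightarrow> ('r, 'a) fm \<Rightarrow> nat" where
  "cost s (Eq x y) = s EqSym"
| "cost s (Rel R xs) = s (RelSym R)"
| "cost s (Quant M xss \<phi>s) = s (QuantSym M) + sum_list (map (cost s) \<phi>s)"

definition basic :: "'r set \<Rightarrow> ('r \<Rightarrow> nat) \<Rightarrow> 'a minor set \<Rightarrow> ('r, 'a) fm \<Rightarrow> bool" where
  "basic \<tau> ar \<M> \<phi> \<longleftrightarrow> (\<exists>x y. \<phi> = Eq x y) \<or>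
     (\<exists>R xs. R \<in> \<tau> \<and> length xs = ar R \<and> \<phi> = Rel R xs) \<or>
     (\<exists>M\<in>\<M>. width M = 0 \<and> \<phi> = Quant M [] [])"

definition s_min ::
    "'r set \<Rightarrow> ('r \<Rightarrow> nat) \<Rightarrow> 'a minor set \<Rightarrow> (('r, 'a) symbol \<Rightarrow> nat) \<Rightarrow> nat" where
  "s_min \<tau> ar \<M> s = (LEAST c. \<exists>\<phi>. basic \<tau> ar \<M> \<phi> \<and> cost s \<phi> = c)"


section \<open>The game\<close>

type_synonym ('r, 'a) position = "nat \<times> ('r, 'a) pair set \<times> ('r, 'a) pair set"

text \<open>
  What Player I does in one round: the formula of step 1 and, for step 2, the quantifier, the
  variables, the budgets and, for the members of the left and of the right class, the lists of
  witness sets and of falsifier sets.  A pair lying in both classes may be treated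
  differently in its two roles.
\<close>

record ('r, 'a) round_choice =
  guess :: "('r, 'a) fm"
  quantf :: "'a minor"
  vars :: "var list list"
  budgets :: "nat list"
  wit_left :: "('r, 'a) pair \<Rightarrow> 'a list set list"
  fal_left :: "('r, 'a) pair \<Rightarrow> 'a list set list"
  wit_right :: "('r, 'a) pair \<Rightarrow> 'a list set list"
  fal_right :: "('r, 'a) pair \<Rightarrow> 'a list set list"

definition legal_guess :: "'r set \<Rightarrow> ('r \<Rightarrow> nat) \<Rightarrow> 'a minor set \<Rightarrow>
    (('r, 'a) symbol \<Rightarrow> nat) \<Rightarrow> ('r, 'a) position \<Rightarrow> ('r, 'a) round_choice \<Rightarrow> bool" where
  "legal_guess \<tau> ar \<M> s p m \<longleftrightarrow> (case p of (c, \<A>, \<B>) \<Rightarrow>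
     s_min \<tau> ar \<M> s \<le> c \<and> basic \<tau> ar \<M> (guess m) \<and> cost s (guess m) \<le> c)"

definition guess_separates :: "('r, 'a) position \<Rightarrow> ('r, 'a) round_choice \<Rightarrow> bool" where
  "guess_separates p m \<longleftrightarrow> (case p of (c, \<A>, \<B>) \<Rightarrow> separates (guess m) \<A> \<B>)"

text \<open>
  Witness sets must respect repetitions of variables.  Falsifier sets may also contain tuples
  that do not respect them, but such tuples do not contribute to the next position: in the
  semantics of a minor quantifier the negative relations are only required to avoid the
  extension of the formula, and no tuple violating repetitions is in that extension.

  If falsifier sets had to respect repetitions as well, a formula could say more than Player I
  can use.  Let \<open>Q = {(D, P). P \<noteq> D\<^sup>2}\<close>, with \<open>\<C>\<close> consisting of the structures
  \<open>(D, \<emptyset>, {t})\<close> for \<open>t \<in> D\<^sup>2\<close> and \<open>\<D>\<close> of the structures \<open>(D, D\<^sup>2, \<emptyset>)\<close>, and let all costs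
  be \<open>1\<close>.  With empty assignments, \<open>M (x, x) (P(x))\<close> has cost \<open>2\<close> and separates
  \<open>{({0, 1}, P = {0, 1}), ({0}, P = \<emptyset>)}\<close> from \<open>{({0}, P = {0})}\<close>, using the negative relation
  \<open>{(0, 1)}\<close> in the first model; but with repetitions respected in all chosen sets, Player I
  would lose from budget \<open>2\<close>.  For tuples of pairwise distinct variables the two rules
  coincide.
\<close>

definition legal_sets ::
    "'a wstruct set \<Rightarrow> nat list \<Rightarrow> var list list \<Rightarrow> 'a set \<Rightarrow>
     'a list set list \<Rightarrow> 'a list set list \<Rightarrow> bool" where
  "legal_sets C n xss D Ps Ns \<longleftrightarrow>
     length Ps = length n \<and> length Ns = length n \<and>
     (\<forall>j<length n. Ps ! j \<subseteq> tuples D (n ! j) \<and> Ns ! j \<subseteq> tuples D (n ! j) \<and>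
        (\<forall>cs\<in>Ps ! j. respects_reps (xss ! j) cs)) \<and>
     (D, Ps, Ns) \<in> C"

definition legal_move :: "'a minor set \<Rightarrow> (('r, 'a) symbol \<Rightarrow> nat) \<Rightarrow>
    ('r, 'a) position \<Rightarrow> ('r, 'a) round_choice \<Rightarrow> bool" where
  "legal_move \<M> s p m \<longleftrightarrow> (case p of (c, \<A>, \<B>) \<Rightarrow>
     let M = quantf m in
     M \<in> \<M> \<and> 0 < width M \<and> map length (vars m) = mtype M \<and>
     length (budgets m) = width M \<and> (\<forall>u\<in>set (budgets m). 0 < u) \<and>
     sum_list (budgets m) + s (QuantSym M) = c \<and>
     (\<forall>q\<in>\<A>. legal_sets (pos M) (mtype M) (vars m) (univ (fst q)) (wit_left m q) (fal_left m q)) \<and>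
     (\<forall>q\<in>\<B>. legal_sets (neg M) (mtype M) (vars m) (univ (fst q)) (wit_right m q) (fal_right m q)))"

text \<open>The updated assignment only exists for tuples that respect repetitions.\<close>

definition extend_pairs ::
    "var list \<Rightarrow> (('r, 'a) pair \<Rightarrow> 'a list set) \<Rightarrow> ('r, 'a) pair set \<Rightarrow> ('r, 'a) pair set" where
  "extend_pairs xs P S =
     {(\<CC>, h(xs [\<mapsto>] cs)) | \<CC> h cs. (\<CC>, h) \<in> S \<and> cs \<in> P (\<CC>, h) \<and> respects_reps xs cs}"

definition next_position ::
    "('r, 'a) position \<Rightarrow> ('r, 'a) round_choice \<Rightarrow> nat \<Rightarrow> ('r, 'a) position" where
  "next_position p m j = (case p of (c, \<A>, \<B>) \<Rightarrow>
     (budgets m ! j,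
      extend_pairs (vars m ! j) (\<lambda>q. wit_left m q ! j) \<A> \<union>
      extend_pairs (vars m ! j) (\<lambda>q. wit_right m q ! j) \<B>,
      extend_pairs (vars m ! j) (\<lambda>q. fal_left m q ! j) \<A> \<union>
      extend_pairs (vars m ! j) (\<lambda>q. fal_right m q ! j) \<B>))"

text \<open>
  A strategy of Player I prescribes his choices from the sequence of positions visited so far,
  latest first.  \<open>wins_with \<dots> \<sigma> (p # hist)\<close> says that if the play has reached \<open>p\<close> through
  \<open>hist\<close> and Player I follows \<open>\<sigma>\<close> from now on, then all his choices are legal and, whatever
  Player II does, the play ends, after finitely many rounds, with a win of Player I.  Every other
  outcome (too small a budget, or no legal choice) is a win of Player II.
\<close>

type_synonym ('r, 'a) strategy = "('r, 'a) position list \<Rightarrow> ('r, 'a) round_choice"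

inductive wins_with :: "'r set \<Rightarrow> ('r \<Rightarrow> nat) \<Rightarrow> 'a minor set \<Rightarrow> (('r, 'a) symbol \<Rightarrow> nat) \<Rightarrow>
    ('r, 'a) strategy \<Rightarrow> ('r, 'a) position list \<Rightarrow> bool"
  for \<tau> ar \<M> s \<sigma> where
    immediate: "legal_guess \<tau> ar \<M> s p (\<sigma> (p # hist)) \<Longrightarrow> guess_separates p (\<sigma> (p # hist)) \<Longrightarrow>
       wins_with \<tau> ar \<M> s \<sigma> (p # hist)"
  | continue: "legal_guess \<tau> ar \<M> s p (\<sigma> (p # hist)) \<Longrightarrow> \<not> guess_separates p (\<sigma> (p # hist)) \<Longrightarrow>
       legal_move \<M> s p (\<sigma> (p # hist)) \<Longrightarrow>
       (\<And>j. j < width (quantf (\<sigma> (p # hist))) \<Longrightarrow>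
          wins_with \<tau> ar \<M> s \<sigma> (next_position p (\<sigma> (p # hist)) j # p # hist)) \<Longrightarrow>
       wins_with \<tau> ar \<M> s \<sigma> (p # hist)"

definition player_I_wins_FC :: "'r set \<Rightarrow> ('r \<Rightarrow> nat) \<Rightarrow> 'a minor set \<Rightarrow>
    (('r, 'a) symbol \<Rightarrow> nat) \<Rightarrow> nat \<Rightarrow> ('r, 'a) pair set \<Rightarrow> ('r, 'a) pair set \<Rightarrow> bool" where
  "player_I_wins_FC \<tau> ar \<M> s b \<A> \<B> \<longleftrightarrow> (\<exists>\<sigma>. wins_with \<tau> ar \<M> s \<sigma> [(b, \<A>, \<B>)])"

end

theory Submission
  imports Defs
begin

text \<open>
  A round of the game mirrors one layer of the syntax tree of a formula, so the two sides of the
  equivalence are linked by one invariant: a position \<open>(c, \<A>, \<B>)\<close> is separable if some formula of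
  cost at most \<open>c\<close> separates \<open>\<A>\<close> from \<open>\<B>\<close>.

  The semantics asks, for truth of \<open>M \<xx>\<^sub>1, \<dots> (\<phi>\<^sub>1, \<dots>)\<close> at a pair, for a structure in \<open>pos M\<close> that
  fits the extensions of the \<open>\<phi>\<^sub>j\<close>.  The game, however, makes Player I certify falsity on the
  right-hand class in the same positive manner, by structures from \<open>neg M\<close>.  That the two agree is
  the point of minors: \<open>pos M\<close> witnesses a quantifier and \<open>neg M\<close> its complement, so the
  extensions fit a member of exactly one of them (\<open>neg_fits_iff_no_pos_fits\<close>).  Moreover, a legal
  choice of witness and falsifier sets fits the extensions of the \<open>\<phi>\<^sub>j\<close> precisely if each \<open>\<phi>\<^sub>j\<close> is
  true at the extended assignments given by the witnesses and false at those given by the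
  falsifiers that respect repetitions (\<open>fits_iff_splits\<close>).  Taken over all pairs, this says that \<open>\<phi>\<^sub>j\<close> separates the \<open>j\<close>-th position
  open to Player II.

  Consequently formulas separating all the next positions combine, under the chosen quantifier, to
  a formula separating the current one (\<open>separable_if_next_separable\<close>), and conversely a formula
  with a quantifier of positive width in front tells Player I how to play so that all next
  positions are again separable (\<open>separable_round\<close>).  The first fact turns a
  win into a formula.  For the second, Player I always plays some choice that keeps the position
  separable; the play must end because quantifiers cost something, so the budget drops strictly.
  Budgets have to be used up exactly while costs are only bounded above; the surplus is
  given to the first subformula.
\<close>

section \<open>Extensions and minors\<close>

definition extension ::
    "nat \<Rightarrow> var list \<Rightarrow> ('r, 'a) pair \<Rightarrow> ('r, 'a) fm \<Rightarrow> 'a list set" where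
  "extension n xs q \<phi> = {cs \<in> tuples (univ (fst q)) n.
     respects_reps xs cs \<and> sat (fst q) ((snd q)(xs [\<mapsto>] cs)) \<phi>}"

definition extension_struct ::
    "nat list \<Rightarrow> var list list \<Rightarrow> ('r, 'a) fm list \<Rightarrow> ('r, 'a) pair \<Rightarrow> 'a qstruct" where
  "extension_struct n xss \<phi>s q =
     (univ (fst q), map (\<lambda>j. extension (n ! j) (xss ! j) q (\<phi>s ! j)) [0..<length n])"

lemma extension_struct_in_qstructs:
  "univ (fst q) \<noteq> {} \<Longrightarrow> extension_struct n xss \<phi>s q \<in> qstructs n"
  by (auto simp: qstructs_def extension_struct_def extension_def)

lemma fits_extension_struct_iff:
  "fits n (D, Ps, Ns) (extension_struct n xss \<phi>s q) \<longleftrightarrow> D = univ (fst q) \<and>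
     (\<forall>j<length n. Ps ! j \<subseteq> extension (n ! j) (xss ! j) q (\<phi>s ! j) \<and>
        Ns ! j \<subseteq> tuples (univ (fst q)) (n ! j) - extension (n ! j) (xss ! j) q (\<phi>s ! j))"
  by (auto simp: fits_def extension_struct_def)

lemma sat_Quant_iff_pos_fits:
  assumes "length \<phi>s = width M"
  shows "sat (fst q) (snd q) (Quant M xss \<phi>s) \<longleftrightarrow>
    (\<exists>W\<in>pos M. fits (mtype M) W (extension_struct (mtype M) xss \<phi>s q))"
    (is "?L \<longleftrightarrow> ?R")
proof -
  have "?R \<longleftrightarrow> (\<exists>D Ps Ns. (D, Ps, Ns) \<in> pos M \<and>
      fits (mtype M) (D, Ps, Ns) (extension_struct (mtype M) xss \<phi>s q))"
    by (metis prod_cases3)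
  also have "\<dots> \<longleftrightarrow> ?L"
    using assms
    by (simp add: fits_extension_struct_iff extension_def width_def Let_def)
  finally show ?thesis by blast
qed

text \<open>
  Whichever of the quantifier and its complement contains \<open>S\<close>, the class witnessing it has a
  member that fits \<open>S\<close>; the other class has none, because a witness structure never fits
  a structure outside the quantifier it witnesses.
\<close>

lemma neg_fits_iff_no_pos_fits:
  assumes "minor_quantifier M" and "S \<in> qstructs (mtype M)"
  shows "(\<exists>W\<in>neg M. fits (mtype M) W S) \<longleftrightarrow> \<not> (\<exists>W\<in>pos M. fits (mtype M) W S)"
  using assms unfolding minor_quantifier_def is_minor_of_def witnesses_def gen_quantifier_def
  by blast

lemma minor_sides_in_wstructs:
  assumes "minor_quantifier M"
  shows "pos M \<subseteq> wstructs (mtype M)" "neg M \<subseteq> wstructs (mtype M)"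
  using assms by (auto simp: minor_quantifier_def is_minor_of_def witnesses_def)

lemma not_sat_Quant_iff_neg_fits:
  assumes "minor_quantifier M" and "length \<phi>s = width M" and "univ (fst q) \<noteq> {}"
  shows "\<not> sat (fst q) (snd q) (Quant M xss \<phi>s) \<longleftrightarrow>
    (\<exists>W\<in>neg M. fits (mtype M) W (extension_struct (mtype M) xss \<phi>s q))"
  unfolding sat_Quant_iff_pos_fits[OF assms(2)]
  by (rule neg_fits_iff_no_pos_fits[OF assms(1) extension_struct_in_qstructs[OF assms(3)],
        symmetric])


section \<open>Chosen sets and the separation of next positions\<close>

text \<open>
  What a single pair \<open>q\<close> contributes to the condition that \<open>\<phi>\<close> separates a next position.  Tuples
  violating repetitions are ignored, as they do not reach the next position.
\<close>

definition splits :: "var list \<Rightarrow> ('r, 'a) fm \<Rightarrow> ('r, 'a) pair \<Rightarrow>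
    'a list set \<Rightarrow> 'a list set \<Rightarrow> bool" where
  "splits xs \<phi> q P N \<longleftrightarrow> (\<forall>cs. respects_reps xs cs \<longrightarrow>
     (cs \<in> P \<longrightarrow> sat (fst q) ((snd q)(xs [\<mapsto>] cs)) \<phi>) \<and>
     (cs \<in> N \<longrightarrow> \<not> sat (fst q) ((snd q)(xs [\<mapsto>] cs)) \<phi>))"

lemma separates_next_position_iff:
  "separates \<phi> (fst (snd (next_position (c, \<A>, \<B>) m j))) (snd (snd (next_position (c, \<A>, \<B>) m j)))
   \<longleftrightarrow> (\<forall>q\<in>\<A>. splits (vars m ! j) \<phi> q (wit_left m q ! j) (fal_left m q ! j)) \<and>
       (\<forall>q\<in>\<B>. splits (vars m ! j) \<phi> q (wit_right m q ! j) (fal_right m q ! j))"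
  by (fastforce simp: separates_def next_position_def extend_pairs_def splits_def)

text \<open>
  A tuple violating repetitions is never in an extension, so it is harmless in a falsifier set; in a
  witness set it is excluded by legality.
\<close>

lemma fits_iff_splits:
  assumes "legal_sets C n xss (univ (fst q)) Ps Ns"
  shows "fits n (univ (fst q), Ps, Ns) (extension_struct n xss \<phi>s q) \<longleftrightarrow>
    (\<forall>j<length n. splits (xss ! j) (\<phi>s ! j) q (Ps ! j) (Ns ! j))"
  using assms
  by (simp add: fits_extension_struct_iff extension_def splits_def legal_sets_def) blast

lemma legal_sets_if_fits:
  assumes "fits n W (extension_struct n xss \<phi>s q)" and "W \<in> C" and "C \<subseteq> wstructs n"
  shows "\<exists>Ps Ns. W = (univ (fst q), Ps, Ns) \<and> legal_sets C n xss (univ (fst q)) Ps Ns"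
proof -
  obtain D Ps Ns where W: "W = (D, Ps, Ns)" by (rule prod_cases3)
  have "D = univ (fst q)"
    using assms(1) by (simp add: W fits_extension_struct_iff)
  moreover have "legal_sets C n xss (univ (fst q)) Ps Ns"
    using assms unfolding W legal_sets_def fits_extension_struct_iff
    by (fastforce simp: extension_def wstructs_def)
  ultimately show ?thesis using W by blast
qed

text \<open>
  The form in which fitting structures enter a round: a fitting member of either side of a minor is
  the same as a legal choice of sets that splits every subformula.
\<close>

lemma ex_fits_iff_legal_splits:
  assumes "C \<subseteq> wstructs n"
  shows "(\<exists>W\<in>C. fits n W (extension_struct n xss \<phi>s q)) \<longleftrightarrow>
    (\<exists>Ps Ns. legal_sets C n xss (univ (fst q)) Ps Ns \<and>
       (\<forall>j<length n. splits (xss ! j) (\<phi>s ! j) q (Ps ! j) (Ns ! j)))"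
    (is "?L \<longleftrightarrow> ?R")
proof
  assume ?L
  then obtain W where W: "W \<in> C" "fits n W (extension_struct n xss \<phi>s q)" by blast
  with legal_sets_if_fits[OF W(2,1) assms] show ?R
    using fits_iff_splits by blast
next
  assume ?R
  then obtain Ps Ns where L: "legal_sets C n xss (univ (fst q)) Ps Ns"
    and "\<forall>j<length n. splits (xss ! j) (\<phi>s ! j) q (Ps ! j) (Ns ! j)" by blast
  then have "fits n (univ (fst q), Ps, Ns) (extension_struct n xss \<phi>s q)"
    by (simp add: fits_iff_splits)
  with L show ?L by (auto simp: legal_sets_def)
qed


section \<open>From a winning strategy to a formula\<close>

definition separable :: "'r set \<Rightarrow> ('r \<Rightarrow> nat) \<Rightarrow> 'a minor set \<Rightarrow>
    (('r, 'a) symbol \<Rightarrow> nat) \<Rightarrow> ('r, 'a) position \<Rightarrow> bool" where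
  "separable \<tau> ar \<M> s p \<longleftrightarrow>
     (\<exists>\<phi>. FO \<tau> ar \<M> \<phi> \<and> cost s \<phi> \<le> fst p \<and> separates \<phi> (fst (snd p)) (snd (snd p)))"

lemma basic_imp_FO: "basic \<tau> ar \<M> \<phi> \<Longrightarrow> FO \<tau> ar \<M> \<phi>"
  by (auto simp: basic_def width_def intro: FO.intros)

lemma separable_if_guess:
  assumes "legal_guess \<tau> ar \<M> s p m" and "guess_separates p m"
  shows "separable \<tau> ar \<M> s p"
  using assms basic_imp_FO
  by (fastforce simp: separable_def legal_guess_def guess_separates_def)

lemma separable_if_next_separable:
  assumes min: "\<forall>M\<in>\<M>. minor_quantifier M"
    and move: "legal_move \<M> s p m"
    and "next": "\<And>j. j < width (quantf m) \<Longrightarrow> separable \<tau> ar \<M> s (next_position p m j)"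
  shows "separable \<tau> ar \<M> s p"
proof -
  obtain c \<A> \<B> where p: "p = (c, \<A>, \<B>)" by (rule prod_cases3)
  define M where "M = quantf m"
  have M: "M \<in> \<M>" "map length (vars m) = mtype M" "length (budgets m) = width M"
      "sum_list (budgets m) + s (QuantSym M) = c"
    and left: "\<And>q. q \<in> \<A> \<Longrightarrow>
      legal_sets (pos M) (mtype M) (vars m) (univ (fst q)) (wit_left m q) (fal_left m q)"
    and right: "\<And>q. q \<in> \<B> \<Longrightarrow>
      legal_sets (neg M) (mtype M) (vars m) (univ (fst q)) (wit_right m q) (fal_right m q)"
    using move by (auto simp: legal_move_def p M_def Let_def)
  have minM: "minor_quantifier M" using min M(1) by blast
  have "\<forall>j. \<exists>\<phi>. j < width M \<longrightarrow> FO \<tau> ar \<M> \<phi> \<and> cost s \<phi> \<le> budgets m ! j \<and>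
      separates \<phi> (fst (snd (next_position p m j))) (snd (snd (next_position p m j)))"
    using "next" by (force simp: separable_def M_def p next_position_def)
  then obtain \<psi> where \<psi>: "\<And>j. j < width M \<Longrightarrow> FO \<tau> ar \<M> (\<psi> j) \<and> cost s (\<psi> j) \<le> budgets m ! j \<and>
      separates (\<psi> j) (fst (snd (next_position p m j))) (snd (snd (next_position p m j)))"
    by metis
  define \<phi>s where "\<phi>s = map \<psi> [0..<width M]"
  have len: "length \<phi>s = width M" by (simp add: \<phi>s_def)
  have split_left: "\<forall>j<length (mtype M).
      splits (vars m ! j) (\<phi>s ! j) q (wit_left m q ! j) (fal_left m q ! j)"
    if "q \<in> \<A>" for q
    using \<psi> that by (auto simp: p separates_next_position_iff \<phi>s_def width_def)
  have split_right: "\<forall>j<length (mtype M).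
      splits (vars m ! j) (\<phi>s ! j) q (wit_right m q ! j) (fal_right m q ! j)"
    if "q \<in> \<B>" for q
    using \<psi> that by (auto simp: p separates_next_position_iff \<phi>s_def width_def)
  have "sat (fst q) (snd q) (Quant M (vars m) \<phi>s)" if "q \<in> \<A>" for q
    unfolding sat_Quant_iff_pos_fits[OF len]
      ex_fits_iff_legal_splits[OF minor_sides_in_wstructs(1)[OF minM]]
    using left[OF that] split_left[OF that] by blast
  moreover have "\<not> sat (fst q) (snd q) (Quant M (vars m) \<phi>s)" if "q \<in> \<B>" for q
  proof -
    have ne: "univ (fst q) \<noteq> {}"
      using right[OF that] minor_sides_in_wstructs(2)[OF minM]
      by (auto simp: legal_sets_def wstructs_def)
    then show ?thesis
      unfolding not_sat_Quant_iff_neg_fits[OF minM len ne]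
        ex_fits_iff_legal_splits[OF minor_sides_in_wstructs(2)[OF minM]]
      using right[OF that] split_right[OF that] by blast
  qed
  ultimately have "separates (Quant M (vars m) \<phi>s) \<A> \<B>"
    unfolding separates_def by (auto simp del: sat.simps)
  moreover have "FO \<tau> ar \<M> (Quant M (vars m) \<phi>s)"
    using M len \<psi> by (intro FO.intros) (auto simp: \<phi>s_def)
  moreover have "sum_list (map (cost s) \<phi>s) \<le> sum_list (budgets m)"
    unfolding sum_list_sum_nth using \<psi> M(3) by (auto simp: \<phi>s_def intro!: sum_mono)
  then have "cost s (Quant M (vars m) \<phi>s) \<le> c" using M(4) by simp
  ultimately show ?thesis unfolding separable_def p fst_conv snd_conv by blast
qed

lemma wins_with_imp_separable:
  assumes "wins_with \<tau> ar \<M> s \<sigma> h" and "\<forall>M\<in>\<M>. minor_quantifier M"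
  shows "separable \<tau> ar \<M> s (hd h)"
  using assms(1)
proof (induction rule: wins_with.induct)
  case (immediate p hist)
  then show ?case by (simp add: separable_if_guess)
next
  case (continue p hist)
  then show ?case
    using separable_if_next_separable[OF assms(2) continue.hyps(3)] by simp
qed


section \<open>From a formula to a winning strategy\<close>

lemma FO_cost_pos:
  assumes "FO \<tau> ar \<M> \<phi>" and "\<forall>\<alpha>\<in>symbols \<tau> \<M>. 0 < s \<alpha>"
  shows "0 < cost s \<phi>"
  using assms by (auto elim!: FO.cases simp: symbols_def)

text \<open>Every formula has a leaf, which is a formula that Player I may guess.\<close>

lemma s_min_le_FO_cost:
  assumes "FO \<tau> ar \<M> \<phi>"
  shows "s_min \<tau> ar \<M> s \<le> cost s \<phi>"
  using assms
proof (induction rule: FO.induct)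
  case (1 x y)
  then show ?case unfolding s_min_def by (intro Least_le exI[of _ "Eq x y"]) (auto simp: basic_def)
next
  case (2 R xs)
  then show ?case unfolding s_min_def by (intro Least_le exI[of _ "Rel R xs"]) (auto simp: basic_def)
next
  case (3 M xss \<phi>s)
  show ?case
  proof (cases "width M = 0")
    case True
    with 3 have "basic \<tau> ar \<M> (Quant M xss \<phi>s)" by (auto simp: basic_def width_def)
    then show ?thesis unfolding s_min_def by (intro Least_le) blast
  next
    case False
    with 3 have "\<phi>s ! 0 \<in> set \<phi>s" by simp
    then have "cost s (\<phi>s ! 0) \<le> sum_list (map (cost s) \<phi>s)"
      by (simp add: member_le_sum_list)
    with \<open>\<phi>s ! 0 \<in> set \<phi>s\<close> 3 show ?thesis by fastforce
  qed
qed

lemma ex_basic_cost_s_min: "\<exists>\<phi>. basic \<tau> ar \<M> \<phi> \<and> cost s \<phi> = s_min \<tau> ar \<M> s"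
proof -
  have "basic \<tau> ar \<M> (Eq 0 0)" by (simp add: basic_def)
  then have "\<exists>\<phi>. basic \<tau> ar \<M> \<phi> \<and> cost s \<phi> = cost s (Eq 0 0)" by blast
  then show ?thesis
    unfolding s_min_def by (rule LeastI[where P = "\<lambda>c. \<exists>\<phi>. basic \<tau> ar \<M> \<phi> \<and> cost s \<phi> = c"])
qed

text \<open>
  A minor decides only structures with non-empty domain, so falsity on the right-hand class yields
  falsifying structures from \<open>neg M\<close> only there.  Non-emptiness is therefore carried along the play.
\<close>

definition nonempty_position :: "('r, 'a) position \<Rightarrow> bool" where
  "nonempty_position p \<longleftrightarrow> (\<forall>q \<in> fst (snd p) \<union> snd (snd p). univ (fst q) \<noteq> {})"

lemma extend_pairs_same_model:
  "q \<in> extend_pairs xs P S \<Longrightarrow> \<exists>q'\<in>S. fst q' = fst q"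
  by (force simp: extend_pairs_def)

lemma nonempty_next_position:
  assumes "nonempty_position p"
  shows "nonempty_position (next_position p m j)"
proof -
  obtain c \<A> \<B> where p: "p = (c, \<A>, \<B>)" by (rule prod_cases3)
  have "\<forall>q\<in>\<A> \<union> \<B>. univ (fst q) \<noteq> {}"
    using assms by (simp add: nonempty_position_def p)
  then show ?thesis
    unfolding nonempty_position_def next_position_def p case_prod_conv fst_conv snd_conv
    by (metis UnE UnI1 UnI2 extend_pairs_same_model)
qed

definition good_round :: "'r set \<Rightarrow> ('r \<Rightarrow> nat) \<Rightarrow> 'a minor set \<Rightarrow> (('r, 'a) symbol \<Rightarrow> nat) \<Rightarrow>
    ('r, 'a) position \<Rightarrow> ('r, 'a) round_choice \<Rightarrow> bool" where
  "good_round \<tau> ar \<M> s p m \<longleftrightarrow> legal_guess \<tau> ar \<M> s p m \<and>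
     (guess_separates p m \<or> legal_move \<M> s p m \<and>
        (\<forall>j<width (quantf m). separable \<tau> ar \<M> s (next_position p m j)))"

text \<open>
  A separating formula that may be guessed ends the game at once.  Otherwise its outermost
  quantifier is played; since a round starts with a guess in any case, a cheapest one is made, which
  the budget allows because it is no dearer than a leaf of the separating formula.
\<close>

lemma separable_round:
  fixes p :: "('r, 'a) position"
  assumes min: "\<forall>M\<in>\<M>. minor_quantifier M"
    and cost_pos: "\<forall>\<alpha>\<in>symbols \<tau> \<M>. 0 < s \<alpha>"
    and ne: "nonempty_position p"
    and sep: "separable \<tau> ar \<M> s p"
  shows "\<exists>m. good_round \<tau> ar \<M> s p m"
proof -
  obtain c \<A> \<B> where p: "p = (c, \<A>, \<B>)" by (rule prod_cases3)
  obtain \<phi> where \<phi>: "FO \<tau> ar \<M> \<phi>" "cost s \<phi> \<le> c" "separates \<phi> \<A> \<B>"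
    using sep by (auto simp: separable_def p)
  have s_min: "s_min \<tau> ar \<M> s \<le> c"
    using s_min_le_FO_cost[OF \<phi>(1)] \<phi>(2) by (rule le_trans)
  show ?thesis
  proof (cases "basic \<tau> ar \<M> \<phi>")
    case True
    obtain m :: "('r, 'a) round_choice" where "guess m = \<phi>"
      by (metis round_choice.select_convs(1))
    with True \<phi> s_min have "good_round \<tau> ar \<M> s p m"
      by (simp add: good_round_def legal_guess_def guess_separates_def p)
    then show ?thesis ..
  next
    case False
    with \<phi>(1) obtain M xss \<phi>s where \<phi>_eq: "\<phi> = Quant M xss \<phi>s"
      and M: "M \<in> \<M>" "map length xss = mtype M" "length \<phi>s = width M"
      and FO: "\<forall>\<psi>\<in>set \<phi>s. FO \<tau> ar \<M> \<psi>"
      by (cases rule: FO.cases) (auto simp: basic_def)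
    have width: "0 < width M"
      using False M by (auto simp: \<phi>_eq basic_def width_def)
    have minM: "minor_quantifier M" using min M(1) by blast
    obtain \<psi> where \<psi>: "basic \<tau> ar \<M> \<psi>" "cost s \<psi> = s_min \<tau> ar \<M> s"
      using ex_basic_cost_s_min by blast
    let ?n = "mtype M"
    have "\<exists>Ps Ns. legal_sets (pos M) ?n xss (univ (fst q)) Ps Ns \<and>
        (\<forall>j<length ?n. splits (xss ! j) (\<phi>s ! j) q (Ps ! j) (Ns ! j))" if "q \<in> \<A>" for q
    proof -
      have "sat (fst q) (snd q) \<phi>" using \<phi>(3) that by (auto simp: separates_def)
      then show ?thesis
        unfolding \<phi>_eq sat_Quant_iff_pos_fits[OF M(3)]
          ex_fits_iff_legal_splits[OF minor_sides_in_wstructs(1)[OF minM]] .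
    qed
    then obtain Pl Nl where
      left: "\<And>q. q \<in> \<A> \<Longrightarrow> legal_sets (pos M) ?n xss (univ (fst q)) (Pl q) (Nl q) \<and>
        (\<forall>j<length ?n. splits (xss ! j) (\<phi>s ! j) q (Pl q ! j) (Nl q ! j))"
      by metis
    have "\<exists>Ps Ns. legal_sets (neg M) ?n xss (univ (fst q)) Ps Ns \<and>
        (\<forall>j<length ?n. splits (xss ! j) (\<phi>s ! j) q (Ps ! j) (Ns ! j))" if "q \<in> \<B>" for q
    proof -
      have "\<not> sat (fst q) (snd q) \<phi>" using \<phi>(3) that by (auto simp: separates_def)
      moreover have "univ (fst q) \<noteq> {}" using ne that by (auto simp: nonempty_position_def p)
      ultimately show ?thesis
        unfolding \<phi>_eq not_sat_Quant_iff_neg_fits[OF minM M(3) \<open>univ (fst q) \<noteq> {}\<close>]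
          ex_fits_iff_legal_splits[OF minor_sides_in_wstructs(2)[OF minM]] by blast
    qed
    then obtain Pr Nr where
      right: "\<And>q. q \<in> \<B> \<Longrightarrow> legal_sets (neg M) ?n xss (univ (fst q)) (Pr q) (Nr q) \<and>
        (\<forall>j<length ?n. splits (xss ! j) (\<phi>s ! j) q (Pr q ! j) (Nr q ! j))"
      by metis
    obtain \<phi>0 \<phi>t where \<phi>s: "\<phi>s = \<phi>0 # \<phi>t" using width M(3) by (cases \<phi>s) auto
    \<comment> \<open>The budgets must add up to exactly \<open>c - s(M)\<close>, so the first one absorbs the surplus.\<close>
    define us where "us = (cost s \<phi>0 + (c - cost s \<phi>)) # map (cost s) \<phi>t"
    have us_pos: "\<forall>u\<in>set us. 0 < u"
      using FO FO_cost_pos[OF _ cost_pos] by (auto simp: us_def \<phi>s)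
    have us_sum: "sum_list us + s (QuantSym M) = c"
      using \<phi>(2) by (simp add: us_def \<phi>_eq \<phi>s)
    have us_len: "length us = width M" using M(3) by (simp add: us_def \<phi>s)
    have us_ge: "cost s (\<phi>s ! j) \<le> us ! j" if "j < width M" for j
      using that M(3) by (cases j) (auto simp: us_def \<phi>s)
    define m where "m = \<lparr>guess = \<psi>, quantf = M, vars = xss, budgets = us,
      wit_left = Pl, fal_left = Nl, wit_right = Pr, fal_right = Nr\<rparr>"
    have "legal_guess \<tau> ar \<M> s p m"
      using s_min \<psi> by (simp add: legal_guess_def p m_def)
    moreover have "legal_move \<M> s p m"
      using M width us_pos us_sum us_len left right
      by (simp add: legal_move_def p m_def)
    moreover have "separable \<tau> ar \<M> s (next_position p m j)" if "j < width M" for j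
    proof -
      have "separates (\<phi>s ! j) (fst (snd (next_position p m j))) (snd (snd (next_position p m j)))"
        unfolding p separates_next_position_iff using left right that
        by (simp add: m_def width_def)
      moreover have "cost s (\<phi>s ! j) \<le> fst (next_position p m j)"
        using us_ge[OF that] by (simp add: next_position_def p m_def)
      moreover have "FO \<tau> ar \<M> (\<phi>s ! j)" using FO that M(3) by simp
      ultimately show ?thesis unfolding separable_def by blast
    qed
    ultimately have "good_round \<tau> ar \<M> s p m"
      by (simp add: good_round_def m_def)
    then show ?thesis ..
  qed
qed

lemma budget_decreases:
  assumes "legal_move \<M> s p m" and "\<forall>\<alpha>\<in>symbols \<tau> \<M>. 0 < s \<alpha>" and "j < width (quantf m)"
  shows "fst (next_position p m j) < fst p"
proof -
  obtain c \<A> \<B> where p: "p = (c, \<A>, \<B>)" by (rule prod_cases3)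
  have *: "quantf m \<in> \<M>" "length (budgets m) = width (quantf m)"
      "sum_list (budgets m) + s (QuantSym (quantf m)) = c"
    using assms(1) by (auto simp: legal_move_def p Let_def)
  then have "0 < s (QuantSym (quantf m))" using assms(2) by (simp add: symbols_def)
  moreover have "budgets m ! j \<le> sum_list (budgets m)"
    using *(2) assms(3) by (simp add: member_le_sum_list)
  ultimately show ?thesis using *(3) by (simp add: next_position_def p)
qed

text \<open>
  Keeping the position separable is enough to win: the budget cannot decrease forever, and a
  good round either wins at once or goes on to smaller budgets.  The strategy depends on the
  current position only.
\<close>

lemma separable_imp_wins_with:
  assumes min: "\<forall>M\<in>\<M>. minor_quantifier M"
    and cost_pos: "\<forall>\<alpha>\<in>symbols \<tau> \<M>. 0 < s \<alpha>"
    and "nonempty_position p" and "separable \<tau> ar \<M> s p"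
  shows "wins_with \<tau> ar \<M> s (\<lambda>h. SOME m. good_round \<tau> ar \<M> s (hd h) m) (p # hist)"
    (is "wins_with _ _ _ _ ?\<sigma> _")
  using assms(3,4)
proof (induction "fst p" arbitrary: p hist rule: less_induct)
  case less
  define m where "m = ?\<sigma> (p # hist)"
  have "good_round \<tau> ar \<M> s p m"
    using someI_ex[OF separable_round[OF min cost_pos less.prems]] by (simp add: m_def)
  then have guess: "legal_guess \<tau> ar \<M> s p m"
    and cont: "\<not> guess_separates p m \<Longrightarrow> legal_move \<M> s p m \<and>
      (\<forall>j<width (quantf m). separable \<tau> ar \<M> s (next_position p m j))"
    by (auto simp: good_round_def)
  show ?case
  proof (cases "guess_separates p m")
    case True
    with guess show ?thesis unfolding m_def by (rule wins_with.immediate)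
  next
    case False
    with cont have move: "legal_move \<M> s p m"
      and sep: "\<And>j. j < width (quantf m) \<Longrightarrow> separable \<tau> ar \<M> s (next_position p m j)"
      by auto
    have "wins_with \<tau> ar \<M> s ?\<sigma> (next_position p m j # p # hist)" if "j < width (quantf m)" for j
      using budget_decreases[OF move cost_pos that] nonempty_next_position[OF less.prems(1)]
        sep[OF that]
      by (rule less.hyps)
    with guess False move show ?thesis unfolding m_def by (rule wins_with.continue)
  qed
qed


section \<open>The characterization\<close>

theorem theorem5p8:
  fixes \<tau> :: "'r set"
    and ar :: "'r \<Rightarrow> nat"
    and \<M> :: "'a minor set"
    and s :: "('r, 'a) symbol \<Rightarrow> nat"
    and \<A> \<B> :: "('r, 'a) pair set"
    and b :: nat
  assumes "finite \<tau>"
    and "finite \<M>" and "\<forall>M\<in>\<M>. minor_quantifier M"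
    and "\<forall>\<alpha>\<in>symbols \<tau> \<M>. 0 < s \<alpha>"
    and "\<forall>p\<in>\<A>. is_pair \<tau> ar p" and "\<forall>p\<in>\<B>. is_pair \<tau> ar p"
    and "0 < b"
  shows "player_I_wins_FC \<tau> ar \<M> s b \<A> \<B> \<longleftrightarrow>
    (\<exists>\<phi>. FO \<tau> ar \<M> \<phi> \<and> cost s \<phi> \<le> b \<and> separates \<phi> \<A> \<B>)"
proof -
  have "nonempty_position (b, \<A>, \<B>)"
    using assms(5,6) by (auto simp: nonempty_position_def is_pair_def is_model_def)
  then have "player_I_wins_FC \<tau> ar \<M> s b \<A> \<B> \<longleftrightarrow> separable \<tau> ar \<M> s (b, \<A>, \<B>)"
    unfolding player_I_wins_FC_def
    using wins_with_imp_separable[OF _ assms(3)] separable_imp_wins_with[OF assms(3,4)]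
    by (metis list.sel(1))
  then show ?thesis by (simp add: separable_def)
qed

end
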